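(* Let $N$ be a non-negative integer, let $n>N$ be an integer, let $\beta,\gamma,\delta\in\mathbb{C}$, put $\alpha=-N-1$, and assume $(n-N+\beta)_n\ne0$ and $(\beta+1)_{N+1}\neq0$. Let $\lambda(x)=x(x+\gamma+\delta+1)$. Then the Racah polynomials satisfy $$R_n(\lambda(x);-N-1,\beta,\gamma,\delta)=R_{N+1}(\lambda(x);-N-1,\beta,\gamma,\delta)\,(-1)^{n-N-1}$$ $$\times\, W_{n-N-1}\!\left(\left(i\left(x+\tfrac{\gamma+\delta+1}{2}\right)\right)^2;\ N+\tfrac{\gamma+\delta+3}{2},\ \tfrac{-\gamma-\delta+1}{2},\ \beta+\tfrac{-\gamma+\delta+1}{2},\ \tfrac{\gamma-\delta+1}{2}\right).$$
   Context: $(a)_0=1$, $(a)_n=a(a+1)\cdots(a+n-1)$. Monic Racah polynomials are $R_n(\lambda(x);\alpha,\beta,\gamma,\delta)=r_n\,{}_4F_3\!\left(\begin{array}{c}-n,\ n+\alpha+\beta+1,\ -x,\ x+\gamma+\delta+1\\ \alpha+1,\ \beta+\delta+1,\ \gamma+1\end{array}\Big|1\right)$ with $r_n=\frac{(\alpha+1)_n(\beta+\delta+1)_n(\gamma+1)_n}{(n+\alpha+\beta+1)_n}$; for all $n\ge0$ (also when denominator parameters are non-positive integers) this is read, after cancelling, as $$R_n(\lambda(x);\alpha,\beta,\gamma,\delta)=\frac{1}{(n+\alpha+\beta+1)_n}\sum_{k=0}^n\frac{(-n)_k(n+\alpha+\beta+1)_k(-x)_k(x+\gamma+\delta+1)_k}{k!}(\alpha+1+k)_{n-k}(\beta+\delta+1+k)_{n-k}(\gamma+1+k)_{n-k},$$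 where $\lambda(x)=x(x+\gamma+\delta+1)$. Monic Wilson polynomials are $W_m(y^2;a,b,c,d)=\frac{(-1)^m(a+b)_m(a+c)_m(a+d)_m}{(m+a+b+c+d-1)_m}\,{}_4F_3\!\left(\begin{array}{c}-m,\ m+a+b+c+d-1,\ a+iy,\ a-iy\\ a+b,\ a+c,\ a+d\end{array}\Big|1\right)$, likewise read after cancelling as $$\frac{(-1)^m}{(m+a+b+c+d-1)_m}\sum_{k=0}^m\frac{(-m)_k(m+a+b+c+d-1)_k(a+iy)_k(a-iy)_k}{k!}(a+b+k)_{m-k}(a+c+k)_{m-k}(a+d+k)_{m-k}.$$ *)

theory Defs
  imports Complex_Main "HOL-Computational_Algebra.Polynomial"
begin

text \<open>
  The shifted factorial \<open>(a)\<^sub>n\<close> is \<^const>\<open>pochhammer\<close>. The Racah and Wilson polynomials are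
  given through formulas in an auxiliary variable: \<open>x\<close> with \<open>\<lambda>(x) = x (x + \<gamma> + \<delta> + 1)\<close>,
  respectively \<open>y\<close> with \<open>y\<^sup>2\<close>. The formulas are the terminating hypergeometric sums after
  cancelling the denominator parameters. If the leading factor \<open>(n + \<alpha> + \<beta> + 1)\<^sub>n\<close>
  (respectively \<open>(m + a + b + c + d - 1)\<^sub>m\<close>) vanishes, the value is \<open>0\<close> by the convention
  for division; statements about these polynomials have to exclude that case.
\<close>

definition racah_lambda :: "complex \<Rightarrow> complex \<Rightarrow> complex \<Rightarrow> complex" where
  "racah_lambda \<gamma> \<delta> x = x * (x + \<gamma> + \<delta> + 1)"

definition racah_sum ::
    "nat \<Rightarrow> complex \<Rightarrow> complex \<Rightarrow> complex \<Rightarrow> complex \<Rightarrow> complex \<Rightarrow> complex" where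
  "racah_sum n \<alpha> \<beta> \<gamma> \<delta> x =
     1 / pochhammer (of_nat n + \<alpha> + \<beta> + 1) n *
     (\<Sum>k=0..n.
        pochhammer (- of_nat n) k * pochhammer (of_nat n + \<alpha> + \<beta> + 1) k *
        pochhammer (- x) k * pochhammer (x + \<gamma> + \<delta> + 1) k / fact k *
        pochhammer (\<alpha> + 1 + of_nat k) (n - k) *
        pochhammer (\<beta> + \<delta> + 1 + of_nat k) (n - k) *
        pochhammer (\<gamma> + 1 + of_nat k) (n - k))"

definition racah_poly ::
    "nat \<Rightarrow> complex \<Rightarrow> complex \<Rightarrow> complex \<Rightarrow> complex \<Rightarrow> complex poly" where
  "racah_poly n \<alpha> \<beta> \<gamma> \<delta> =
     (THE p. \<forall>x. poly p (racah_lambda \<gamma> \<delta> x) = racah_sum n \<alpha> \<beta> \<gamma> \<delta> x)"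

definition wilson_sum ::
    "nat \<Rightarrow> complex \<Rightarrow> complex \<Rightarrow> complex \<Rightarrow> complex \<Rightarrow> complex \<Rightarrow> complex" where
  "wilson_sum m a b c d y =
     (- 1) ^ m / pochhammer (of_nat m + a + b + c + d - 1) m *
     (\<Sum>k=0..m.
        pochhammer (- of_nat m) k * pochhammer (of_nat m + a + b + c + d - 1) k *
        pochhammer (a + \<i> * y) k * pochhammer (a - \<i> * y) k / fact k *
        pochhammer (a + b + of_nat k) (m - k) *
        pochhammer (a + c + of_nat k) (m - k) *
        pochhammer (a + d + of_nat k) (m - k))"

definition wilson_poly ::
    "nat \<Rightarrow> complex \<Rightarrow> complex \<Rightarrow> complex \<Rightarrow> complex \<Rightarrow> complex poly" where
  "wilson_poly m a b c d = (THE p. \<forall>y. poly p (y\<^sup>2) = wilson_sum m a b c d y)"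

text \<open>Both definite descriptions are well-defined.\<close>

lemma poly_the_unique:
  fixes g :: "complex \<Rightarrow> complex" and f :: "complex \<Rightarrow> complex" and q :: "complex poly"
  assumes "surj g" and "\<And>x. poly q (g x) = f x"
  shows "poly (THE p. \<forall>x. poly p (g x) = f x) (g z) = f z"
proof -
  have "(THE p. \<forall>x. poly p (g x) = f x) = q"
  proof (rule the_equality)
    show "\<forall>x. poly q (g x) = f x" using assms(2) by blast
  next
    fix p assume p: "\<forall>x. poly p (g x) = f x"
    have "poly p = poly q"
    proof
      fix l obtain x where "l = g x" using assms(1) by (rule surjE)
      then show "poly p l = poly q l" using p assms(2) by simp
    qed
    then show "p = q" by (simp add: poly_eq_poly_eq_iff)
  qed
  then show ?thesis using assms(2) by simp
qed

lemma surj_racah_lambda: "surj (racah_lambda \<gamma> \<delta>)"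
proof (rule surjI)
  fix l
  define s where "s = (\<gamma> + \<delta> + 1) / 2"
  have "racah_lambda \<gamma> \<delta> (csqrt (l + s\<^sup>2) - s) = (csqrt (l + s\<^sup>2))\<^sup>2 - s\<^sup>2"
    unfolding racah_lambda_def s_def by (simp add: field_simps power2_eq_square)
  then show "racah_lambda \<gamma> \<delta> (csqrt (l + ((\<gamma> + \<delta> + 1) / 2)\<^sup>2) - (\<gamma> + \<delta> + 1) / 2) = l"
    by (simp add: s_def)
qed

lemma poly_racah_poly:
  "poly (racah_poly n \<alpha> \<beta> \<gamma> \<delta>) (racah_lambda \<gamma> \<delta> x) = racah_sum n \<alpha> \<beta> \<gamma> \<delta> x"
proof -
  define B where "B k = (\<Prod>j<k. [:of_nat j * (of_nat j + \<gamma> + \<delta> + 1), - 1:])" for k :: nat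
  have B: "poly (B k) (racah_lambda \<gamma> \<delta> x) = pochhammer (- x) k * pochhammer (x + \<gamma> + \<delta> + 1) k"
    for k x
    unfolding B_def racah_lambda_def
    by (induction k) (auto simp: pochhammer_Suc algebra_simps)
  define q where "q = smult (1 / pochhammer (of_nat n + \<alpha> + \<beta> + 1) n)
     (\<Sum>k=0..n. smult (pochhammer (- of_nat n) k * pochhammer (of_nat n + \<alpha> + \<beta> + 1) k / fact k *
        pochhammer (\<alpha> + 1 + of_nat k) (n - k) *
        pochhammer (\<beta> + \<delta> + 1 + of_nat k) (n - k) *
        pochhammer (\<gamma> + 1 + of_nat k) (n - k)) (B k))"
  have "poly q (racah_lambda \<gamma> \<delta> x) = racah_sum n \<alpha> \<beta> \<gamma> \<delta> x" for x
    unfolding q_def racah_sum_def poly_smult poly_sum B by (simp add: mult_ac)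
  then show ?thesis
    unfolding racah_poly_def by (rule poly_the_unique[OF surj_racah_lambda])
qed

lemma poly_wilson_poly: "poly (wilson_poly m a b c d) (y\<^sup>2) = wilson_sum m a b c d y"
proof -
  define B where "B k = (\<Prod>j<k. [:(a + of_nat j)\<^sup>2, 1:])" for k :: nat
  have fac: "(a + \<i> * y + of_nat j) * (a - \<i> * y + of_nat j) = (a + of_nat j)\<^sup>2 + y\<^sup>2" for y j
    by (simp add: algebra_simps power2_eq_square)
  have B: "poly (B k) (y\<^sup>2) = pochhammer (a + \<i> * y) k * pochhammer (a - \<i> * y) k" for k y
  proof -
    have "pochhammer (a + \<i> * y) k * pochhammer (a - \<i> * y) k =
      (\<Prod>j<k. (a + \<i> * y + of_nat j) * (a - \<i> * y + of_nat j))"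
      by (simp add: pochhammer_prod prod.distrib atLeast0LessThan)
    then show ?thesis unfolding B_def by (simp add: fac poly_prod)
  qed
  define q where "q = smult ((- 1) ^ m / pochhammer (of_nat m + a + b + c + d - 1) m)
     (\<Sum>k=0..m. smult (pochhammer (- of_nat m) k * pochhammer (of_nat m + a + b + c + d - 1) k / fact k *
        pochhammer (a + b + of_nat k) (m - k) *
        pochhammer (a + c + of_nat k) (m - k) *
        pochhammer (a + d + of_nat k) (m - k)) (B k))"
  have q: "poly q (y\<^sup>2) = wilson_sum m a b c d y" for y
    unfolding q_def wilson_sum_def poly_smult poly_sum B by (simp add: mult_ac)
  have "surj (\<lambda>y::complex. y\<^sup>2)"
    by (rule surjI[of _ csqrt]) simp
  then show ?thesis
    unfolding wilson_poly_def by (rule poly_the_unique) (rule q)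
qed

end

theory Submission
  imports Defs
begin

text \<open>
  For \<open>\<alpha> = -N-1\<close> the factor \<open>(k-N)\<^bsub>n-k\<^esub>\<close> kills all terms of the Racah sum with \<open>k \<le> N\<close>.
  Put \<open>M = N+1\<close>. In degree \<open>M\<close> only the last term survives, so
  \<open>R\<^bsub>M\<^esub> = (-1)\<^bsup>M\<^esup> (-x)\<^bsub>M\<^esub> (x+\<gamma>+\<delta>+1)\<^bsub>M\<^esub>\<close>. In degree \<open>n = M+m\<close>, shifting \<open>k = M+j\<close> turns the
  remaining terms, one by one, into \<open>R\<^bsub>M\<^esub>\<close> times the terms of the Wilson sum of degree \<open>m\<close>.
\<close>

lemma pochhammer_of_nat_plus_1:
  "pochhammer (1 + of_nat k) l = (fact (k + l) / fact k :: 'a :: field_char_0)"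
  using pochhammer_product'[of "1 :: 'a" k l] by (simp add: field_simps flip: pochhammer_fact)

lemma pochhammer_minus_of_nat:
  assumes "j \<le> m"
  shows "pochhammer (- of_nat m) j = ((- 1) ^ j * fact m / fact (m - j) :: 'a :: field_char_0)"
proof -
  \<comment> \<open>\<open>pochhammer_minus\<close> reverses the product, which then starts at m - j
    + 1; in the form 1 + (m - j) it becomes a quotient of factorials.\<close>
  have "of_nat m - of_nat j + 1 = (1 + of_nat (m - j) :: 'a)"
    using assms by (simp add: of_nat_diff algebra_simps)
  then show ?thesis
    using assms by (simp only: pochhammer_minus pochhammer_of_nat_plus_1) simp
qed

lemma racah_sum_neg_alpha:
  assumes "0 < M"
  shows "racah_sum (M + m) (- of_nat M) \<beta> \<gamma> \<delta> x =
    1 / pochhammer (of_nat m + \<beta> + 1) (M + m) *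
    (\<Sum>j=0..m.
       pochhammer (- of_nat (M + m)) (M + j) * pochhammer (of_nat m + \<beta> + 1) (M + j) *
       pochhammer (- x) (M + j) * pochhammer (x + \<gamma> + \<delta> + 1) (M + j) / fact (M + j) *
       pochhammer (1 + of_nat j) (m - j) *
       pochhammer (\<beta> + \<delta> + 1 + of_nat (M + j)) (m - j) *
       pochhammer (\<gamma> + 1 + of_nat (M + j)) (m - j))"
proof -
  define t where "t k =
    pochhammer (- of_nat (M + m)) k * pochhammer (of_nat m + \<beta> + 1) k *
    pochhammer (- x) k * pochhammer (x + \<gamma> + \<delta> + 1) k / fact k *
    pochhammer (- of_nat M + 1 + of_nat k) (M + m - k) *
    pochhammer (\<beta> + \<delta> + 1 + of_nat k) (M + m - k) *
    pochhammer (\<gamma> + 1 + of_nat k) (M + m - k)" for k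
  have vanish: "t k = 0" if "k < M" for k
  proof -
    \<comment> \<open>The product starts at the non-positive integer -(M - 1 - k) and has M + m - k
      > M - 1 - k factors, so it runs through 0.\<close>
    have "- of_nat M + 1 + of_nat k = (- of_nat (M - 1 - k) :: complex)"
      using that by (simp add: of_nat_diff)
    moreover have "pochhammer (- of_nat (M - 1 - k) :: complex) (M + m - k) = 0"
      using that by (intro pochhammer_of_nat_eq_0_lemma) simp
    ultimately show ?thesis by (simp add: t_def)
  qed
  have "(\<Sum>k=0..M + m. t k) = (\<Sum>k=M..M + m. t k)"
    by (rule sum.mono_neutral_right) (auto intro: vanish)
  also have "\<dots> = (\<Sum>j=0..m. t (M + j))"
    using sum.shift_bounds_cl_nat_ivl[of t 0 M m] by (simp add: add.commute)
  finally show ?thesis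
    by (simp add: racah_sum_def t_def algebra_simps)
qed

text \<open>Case m = 0 of the truncated sum: (-M)_M / M! leaves the sign, and (\<beta>+1)_M cancels
  against the leading factor, hence the nonvanishing hypothesis.\<close>

lemma racah_sum_first_degree:
  assumes "0 < M" and "pochhammer (\<beta> + 1) M \<noteq> 0"
  shows "racah_sum M (- of_nat M) \<beta> \<gamma> \<delta> x =
    (- 1) ^ M * pochhammer (- x) M * pochhammer (x + \<gamma> + \<delta> + 1) M"
  using racah_sum_neg_alpha[OF assms(1), of 0 \<beta> \<gamma> \<delta> x] assms(2)
  by (simp add: pochhammer_same)

text \<open>The two nonvanishing hypotheses concern the leading factors of the Racah sums of degrees
  M + m and M.\<close>

lemma racah_wilson_sum:
  assumes "0 < M"
    and "pochhammer (of_nat m + \<beta> + 1) (M + m) \<noteq> 0"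
    and "pochhammer (\<beta> + 1) M \<noteq> 0"
  shows "racah_sum (M + m) (- of_nat M) \<beta> \<gamma> \<delta> x =
    racah_sum M (- of_nat M) \<beta> \<gamma> \<delta> x * (- 1) ^ m *
    wilson_sum m
      (of_nat M + (\<gamma> + \<delta> + 1) / 2)
      ((- \<gamma> - \<delta> + 1) / 2)
      (\<beta> + (- \<gamma> + \<delta> + 1) / 2)
      ((\<gamma> - \<delta> + 1) / 2)
      (\<i> * (x + (\<gamma> + \<delta> + 1) / 2))"
proof -
  define a b c d y where abcd: "a = of_nat M + (\<gamma> + \<delta> + 1) / 2" "b = (- \<gamma> - \<delta> + 1) / 2"
    "c = \<beta> + (- \<gamma> + \<delta> + 1) / 2" "d = (\<gamma> - \<delta> + 1) / 2"
    "y = \<i> * (x + (\<gamma> + \<delta> + 1) / 2)"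
  \<comment> \<open>Since i * i = -1, \<open>\<i> * y\<close> is -(x + (\<gamma>+\<delta>+1)/2), so
    a + iy and a - iy are the Racah arguments -x and x+\<gamma>+\<delta>+1 shifted by M.\<close>
  have params: "of_nat m + a + b + c + d - 1 = of_nat m + \<beta> + 1 + of_nat M"
    "a + \<i> * y = - x + of_nat M" "a - \<i> * y = x + \<gamma> + \<delta> + 1 + of_nat M"
    "a + b = 1 + of_nat M" "a + c = \<beta> + \<delta> + 1 + of_nat M" "a + d = \<gamma> + 1 + of_nat M"
    by (simp_all add: abcd field_simps flip: mult.assoc)
  define P where "P = pochhammer (of_nat m + \<beta> + 1) M"
  define X where "X = pochhammer (- x) M * pochhammer (x + \<gamma> + \<delta> + 1) M"
  define w where "w j =
    pochhammer (- of_nat m) j * pochhammer (of_nat m + \<beta> + 1 + of_nat M) j *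
    pochhammer (- x + of_nat M) j * pochhammer (x + \<gamma> + \<delta> + 1 + of_nat M) j / fact j *
    pochhammer (1 + of_nat M + of_nat j) (m - j) *
    pochhammer (\<beta> + \<delta> + 1 + of_nat M + of_nat j) (m - j) *
    pochhammer (\<gamma> + 1 + of_nat M + of_nat j) (m - j)" for j
  have split: "pochhammer (of_nat m + \<beta> + 1) (M + m) =
      P * pochhammer (of_nat m + \<beta> + 1 + of_nat M) m"
    by (simp add: P_def pochhammer_product')
  have "P \<noteq> 0" using assms(2) split by auto
  \<comment> \<open>The factors that do not match individually: both sides equal (-1)^(M+j) (M+m)!
    m! / ((m-j)! j! (M+j)!), with j! and (M+j)! trading places.\<close>
  have coeff: "pochhammer (- of_nat (M + m)) (M + j) * pochhammer (1 + of_nat j) (m - j) / fact (M + j) =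
      ((- 1) ^ M * (pochhammer (- of_nat m) j * pochhammer (1 + of_nat M + of_nat j) (m - j) / fact j) :: complex)"
    if "j \<le> m" for j
    using that pochhammer_of_nat_plus_1[of "M + j" "m - j", where 'a = complex]
    by (simp add: pochhammer_minus_of_nat pochhammer_of_nat_plus_1 power_add add.assoc mult_ac
        del: of_nat_add flip: of_nat_add)
  have "pochhammer (- of_nat (M + m)) (M + j) * pochhammer (of_nat m + \<beta> + 1) (M + j) *
       pochhammer (- x) (M + j) * pochhammer (x + \<gamma> + \<delta> + 1) (M + j) / fact (M + j) *
       pochhammer (1 + of_nat j) (m - j) *
       pochhammer (\<beta> + \<delta> + 1 + of_nat (M + j)) (m - j) *
       pochhammer (\<gamma> + 1 + of_nat (M + j)) (m - j) = (- 1) ^ M * X * P * w j" (is "?t j = _")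
    if "j \<le> m" for j
  proof -
    have "?t j = (pochhammer (- of_nat (M + m)) (M + j) * pochhammer (1 + of_nat j) (m - j) / fact (M + j)) *
       pochhammer (of_nat m + \<beta> + 1) (M + j) *
       pochhammer (- x) (M + j) * pochhammer (x + \<gamma> + \<delta> + 1) (M + j) *
       pochhammer (\<beta> + \<delta> + 1 + of_nat (M + j)) (m - j) *
       pochhammer (\<gamma> + 1 + of_nat (M + j)) (m - j)"
      by simp
    also have "\<dots> = (- 1) ^ M * X * P * w j"
      \<comment> \<open>The other factors of length M + j split by (z)_(M+j) = (z)_M (z+M)_j; the
        parts (z)_M form X and P, free of j.\<close>
      unfolding coeff[OF that] by (simp add: w_def X_def P_def pochhammer_product' mult_ac add.assoc)
    finally show ?thesis .
  qed
  then have "racah_sum (M + m) (- of_nat M) \<beta> \<gamma> \<delta> x =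
      1 / pochhammer (of_nat m + \<beta> + 1) (M + m) * (\<Sum>j=0..m. (- 1) ^ M * X * P * w j)"
    unfolding racah_sum_neg_alpha[OF assms(1)]
    by (intro arg_cong2[where f = "(*)", OF refl sum.cong[OF refl]]) simp
  also have "\<dots> = (- 1) ^ M * X / pochhammer (of_nat m + \<beta> + 1 + of_nat M) m * (\<Sum>j=0..m. w j)"
    using \<open>P \<noteq> 0\<close> by (simp add: split flip: sum_distrib_left)
  \<comment> \<open>The explicit sign (-1)^m undoes the one in the monic normalization of
    \<open>wilson_sum\<close>.\<close>
  also have "\<dots> = (- 1) ^ M * X * (- 1) ^ m * wilson_sum m a b c d y"
    by (simp add: wilson_sum_def params w_def flip: power_mult_distrib)
  also have "(- 1) ^ M * X = racah_sum M (- of_nat M) \<beta> \<gamma> \<delta> x"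
    by (simp add: racah_sum_first_degree[OF assms(1,3)] X_def)
  finally show ?thesis by (simp add: abcd)
qed

theorem mainTheorem4:
  fixes N n :: nat and \<beta> \<gamma> \<delta> x :: complex
  assumes "n > N"
    and "pochhammer (of_nat n - of_nat N + \<beta>) n \<noteq> 0"
    and "pochhammer (\<beta> + 1) (N + 1) \<noteq> 0"
  shows "poly (racah_poly n (- of_nat N - 1) \<beta> \<gamma> \<delta>) (racah_lambda \<gamma> \<delta> x) =
    poly (racah_poly (N + 1) (- of_nat N - 1) \<beta> \<gamma> \<delta>) (racah_lambda \<gamma> \<delta> x) *
    (- 1) ^ (n - N - 1) *
    poly (wilson_poly (n - N - 1)
            (of_nat N + (\<gamma> + \<delta> + 3) / 2)
            ((- \<gamma> - \<delta> + 1) / 2)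
            (\<beta> + (- \<gamma> + \<delta> + 1) / 2)
            ((\<gamma> - \<delta> + 1) / 2))
         ((\<i> * (x + (\<gamma> + \<delta> + 1) / 2))\<^sup>2)"
proof -
  define M m where Mm: "M = N + 1" "m = n - N - 1"
  have n: "n = M + m" using assms(1) by (simp add: Mm)
  have \<alpha>: "- of_nat N - 1 = (- of_nat M :: complex)" by (simp add: Mm)
  have a: "of_nat N + (\<gamma> + \<delta> + 3) / 2 = of_nat M + (\<gamma> + \<delta> + 1) / 2"
    by (simp add: Mm field_simps)
  \<comment> \<open>The shift n - N = m + 1 turns the assumed (n-N+\<beta>)_n into the leading
    factor of degree M + m.\<close>
  have "of_nat n - of_nat N + \<beta> = of_nat m + \<beta> + 1"
    using assms(1) by (simp add: Mm(2) of_nat_diff)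
  then have "pochhammer (of_nat m + \<beta> + 1) (M + m) \<noteq> 0" using assms(2) n by metis
  moreover have "pochhammer (\<beta> + 1) M \<noteq> 0" unfolding Mm(1) by (rule assms(3))
  ultimately show ?thesis
    unfolding poly_racah_poly poly_wilson_poly \<alpha> a Mm(1)[symmetric] Mm(2)[symmetric] unfolding n
    by (intro racah_wilson_sum) (auto simp: Mm(1))
qed

end
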